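(* For all real $p>1$ and $x\in(0,1)$ the following inequalities hold: $$\left(\frac{\arcsin_p(x)}{x}\right)^{p} <\frac{\operatorname{arctanh}_p(x)}{x}<\frac{\arcsin_p(x)}{x\,(1-x^p)^{1/p}}$$ and $$\left(\frac{x^p}{1+x^p}\right)^{\frac{1}{p}-1}\left(\arcsin_p\left(\left(\frac{x^p}{1+x^p}\right)^{\frac1p}\right)\right)^p < \operatorname{arcsinh}_p(x)<(1+x^p)^{\frac{1}{p}}\arcsin_p\left(\left(\frac{x^p}{1+x^p}\right)^{\frac{1}{p}}\right).$$ Moreover, the inequality $\frac{\operatorname{arctanh}_p(x)}{x}<\frac{\arcsin_p(x)}{x\,(1-x^p)^{1/p}}$ holds for all $p>0$ and $x\in(0,1)$.
   Context: For real $p>0$ and $x\in(0,1)$, define the generalized inverse trigonometric and hyperbolic functions $$\arcsin_p(x)=\int_0^x(1-t^p)^{-1/p}\,dt,\quad \operatorname{arcsinh}_p(x)=\int_0^x(1+t^p)^{-1/p}\,dt,\quad \operatorname{arctanh}_p(x)=\int_0^x(1-t^p)^{-1}\,dt.$$ *)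

theory Defs
  imports "HOL-Analysis.Analysis"
begin

(* For p > 0 and 0 < x < 1 the integrands are continuous on the compact interval {0..x}
   (0 powr p = 0 agrees with 0^p for p > 0), so the integrals exist.  Outside the
   range p > 0, 0 < x < 1 the values carry no intended meaning. *)

definition arcsin_p :: "real \<Rightarrow> real \<Rightarrow> real" where
  "arcsin_p p x = integral {0..x} (\<lambda>t. (1 - t powr p) powr (- 1 / p))"

definition arcsinh_p :: "real \<Rightarrow> real \<Rightarrow> real" where
  "arcsinh_p p x = integral {0..x} (\<lambda>t. (1 + t powr p) powr (- 1 / p))"

definition arctanh_p :: "real \<Rightarrow> real \<Rightarrow> real" where
  "arctanh_p p x = integral {0..x} (\<lambda>t. inverse (1 - t powr p))"

end

theory Submission imports Defs begin

text \<open>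
  The first chain compares integrals of powers of one function,
  \<open>f t = (1 - t powr p) powr (- 1 / p)\<close>: the integrand of \<open>arcsin_p\<close> is \<open>f\<close>, that of
  \<open>arctanh_p\<close> is \<open>f powr p\<close>.  For \<open>p > 1\<close> the lower bound of \<open>arctanh_p\<close> is therefore Jensen's
  inequality for the power \<open>p\<close> (lemma \<open>powr_mean_less_mean_powr\<close>), strict because \<open>f\<close> is not constant.

  The upper bound \<open>(1 - x powr p) powr (1 / p) * arctanh_p p x < arcsin_p p x\<close> does not follow from a
  pointwise comparison of the integrands when \<open>p > 2\<close>.  Instead both sides vanish at \<open>0\<close>, and the
  difference has positive derivative: differentiating the factor \<open>(1 - x powr p) powr (1 / p)\<close> leaves
  a term with \<open>arctanh_p p x\<close>, for which the trivial bound \<open>x \<le> arctanh_p p x\<close> is already enough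
  (lemma \<open>arctanh_p_less_arcsin_p\<close>).  This argument works for every \<open>p > 0\<close>.

  The second chain is the first one at another point.  The substitution
  \<open>u = t / (1 + t powr p) powr (1 / p)\<close>, for which \<open>u powr p = t powr p / (1 + t powr p)\<close> and
  \<open>1 - u powr p = 1 / (1 + t powr p)\<close>, transforms \<open>arcsinh_p p x\<close> into \<open>arctanh_p p y\<close> with
  \<open>y = (x powr p / (1 + x powr p)) powr (1 / p)\<close> (lemma \<open>arcsinh_p_eq_arctanh_p\<close>).
\<close>

section \<open>Strict Jensen inequality for powers\<close>

text \<open>
  Strict convexity of \<open>u \<mapsto> u powr p\<close>: the graph lies strictly above each of its tangents.
\<close>
lemma powr_gt_tangent:
  fixes p u c :: real
  assumes p: "p > 1" and u: "u > 0" and c: "c > 0" and ne: "u \<noteq> c"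
  shows "c powr p + p * c powr (p - 1) * (u - c) < u powr p"
proof (cases "c < u")
  case True
  have "\<exists>z. c < z \<and> z < u \<and> u powr p - c powr p = (u - c) * (p * z powr (p - 1))"
    by (rule MVT2[OF True]) (use c in \<open>auto intro!: derivative_eq_intros\<close>)
  then obtain z where z: "c < z" "u powr p - c powr p = (u - c) * (p * z powr (p - 1))" by blast
  have "c powr (p - 1) < z powr (p - 1)"
    using z(1) c p by (intro powr_less_mono2) auto
  then have "(u - c) * (p * c powr (p - 1)) < (u - c) * (p * z powr (p - 1))"
    using True p by simp
  with z(2) show ?thesis by (simp add: mult_ac)
next
  case False
  with ne have lt: "u < c" by simp
  have "\<exists>z. u < z \<and> z < c \<and> c powr p - u powr p = (c - u) * (p * z powr (p - 1))"
    by (rule MVT2[OF lt]) (use u in \<open>auto intro!: derivative_eq_intros\<close>)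
  then obtain z where z: "u < z" "z < c" "c powr p - u powr p = (c - u) * (p * z powr (p - 1))"
    by blast
  have "z powr (p - 1) < c powr (p - 1)"
    using z u p by (intro powr_less_mono2) auto
  then have "(c - u) * (p * z powr (p - 1)) < (c - u) * (p * c powr (p - 1))"
    using lt p by simp
  with z(3) show ?thesis by (simp add: algebra_simps)
qed

text \<open>
  Integrate the tangent inequality at the mean \<open>c\<close> of \<open>f\<close>: the linear term integrates to zero.
  Equality would force the continuous nonnegative gap to vanish identically, hence \<open>f = c\<close> everywhere.
\<close>
lemma powr_mean_less_mean_powr:
  fixes f :: "real \<Rightarrow> real"
  assumes p: "p > 1" and ab: "a < b" and cont: "continuous_on {a..b} f"
    and pos: "\<And>t. t \<in> {a..b} \<Longrightarrow> f t > 0"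
    and nonconst: "s \<in> {a..b}" "t \<in> {a..b}" "f s \<noteq> f t"
  shows "(integral {a..b} f / (b - a)) powr p < integral {a..b} (\<lambda>t. f t powr p) / (b - a)"
proof -
  define c where "c = integral {a..b} f / (b - a)"
  define gap where "gap = (\<lambda>t. f t powr p - (c powr p + p * c powr (p - 1) * (f t - c)))"
  have "integral {a..b} f \<noteq> 0"
    using integral_eq_0_iff[OF cont ab] pos ab nonconst(1) by (metis less_imp_le less_irrefl)
  moreover have "integral {a..b} f \<ge> 0"
    using integrable_continuous_real[OF cont] pos by (intro integral_nonneg) (auto intro: less_imp_le)
  ultimately have c: "c > 0" using ab by (simp add: c_def)
  have contp: "continuous_on {a..b} (\<lambda>t. f t powr p)"
    using pos p by (intro continuous_on_powr' cont continuous_on_const) (auto intro: less_imp_le)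
  have contg: "continuous_on {a..b} gap"
    unfolding gap_def by (intro continuous_intros contp cont)
  have gap0: "gap t \<ge> 0" if "t \<in> {a..b}" for t
    using powr_gt_tangent[OF p pos[OF that] c] by (cases "f t = c") (auto simp: gap_def)
  have "integral {a..b} gap \<noteq> 0"
  proof
    assume "integral {a..b} gap = 0"
    then have z: "\<forall>t\<in>{a..b}. gap t = 0"
      using integral_eq_0_iff[OF contg ab] gap0 by blast
    have "f t = c" if "t \<in> {a..b}" for t
      using powr_gt_tangent[OF p pos[OF that] c] z that by (force simp: gap_def)
    with nonconst show False by metis
  qed
  moreover have "integral {a..b} gap \<ge> 0"
    using integrable_continuous_real[OF contg] gap0 by (intro integral_nonneg) auto
  moreover have "(gap has_integral integral {a..b} (\<lambda>t. f t powr p) -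
      ((b - a) * c powr p + p * c powr (p - 1) * (integral {a..b} f - (b - a) * c))) {a..b}"
    unfolding gap_def
    using has_integral_const_real[of "c powr p" a b] has_integral_const_real[of c a b] ab
    by (intro has_integral_diff has_integral_add has_integral_mult_right
        integrable_integral integrable_continuous_real contp cont) simp_all
  then have "integral {a..b} gap = integral {a..b} (\<lambda>t. f t powr p) - (b - a) * c powr p"
    using ab by (simp add: integral_unique c_def)
  ultimately show ?thesis using ab by (simp add: c_def field_simps)
qed

section \<open>Bounds of the inverse hyperbolic tangent\<close>

lemma powr_in_unit:
  fixes p t x :: real
  assumes "p > 0" "x < 1" "t \<in> {0..x}"
  shows "0 \<le> t powr p" "t powr p < 1" "t powr p \<noteq> 1"
  using assms powr_less_mono2[of p t 1] by auto

lemma continuous_on_powr_pos_exponent: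
  fixes p x :: real
  assumes "p > 0"
  shows "continuous_on {0..x} (\<lambda>t. t powr p)"
  using assms by (intro continuous_on_powr') auto

lemma continuous_on_arcsin_p_integrand:
  fixes p x :: real
  assumes "p > 0" "x < 1"
  shows "continuous_on {0..x} (\<lambda>t. (1 - t powr p) powr (- 1 / p))"
  using powr_in_unit[OF assms] assms
  by (intro continuous_on_powr' continuous_intros continuous_on_powr_pos_exponent)
     (auto simp: less_imp_le)

lemma continuous_on_arctanh_p_integrand:
  fixes p x :: real
  assumes "p > 0" "x < 1"
  shows "continuous_on {0..x} (\<lambda>t. inverse (1 - t powr p))"
  using powr_in_unit[OF assms] assms
  by (intro continuous_on_inverse continuous_intros continuous_on_powr_pos_exponent) auto

lemma arctanh_p_ge_self:
  fixes p x :: real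
  assumes "p > 0" "0 \<le> x" "x < 1"
  shows "x \<le> arctanh_p p x"
proof -
  have "integral {0..x} (\<lambda>t. 1::real) \<le> integral {0..x} (\<lambda>t. inverse (1 - t powr p))"
    using powr_in_unit[OF assms(1,3)] continuous_on_arctanh_p_integrand[OF assms(1,3)]
    by (intro integral_le integrable_continuous_real) (auto simp: one_le_inverse_iff)
  then show ?thesis using assms by (simp add: arctanh_p_def)
qed

lemma arcsin_p_powr_less_arctanh_p:
  fixes p x :: real
  assumes p: "p > 1" and x: "0 < x" "x < 1"
  shows "(arcsin_p p x / x) powr p < arctanh_p p x / x"
proof -
  define f where "f = (\<lambda>t::real. (1 - t powr p) powr (- 1 / p))"
  have p0: "p > 0" using p by simp
  note unit = powr_in_unit[OF p0 x(2)]
  have "f x \<noteq> 1"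
    using x p unit[of x] powr_less_one[of x p] by (auto simp: f_def powr_eq_one_iff_gen)
  then have nonconst: "f 0 \<noteq> f x" using p by (simp add: f_def)
  have pos: "f t > 0" if "t \<in> {0..x}" for t
    using unit[OF that] by (simp add: f_def)
  have "(integral {0..x} f / (x - 0)) powr p < integral {0..x} (\<lambda>t. f t powr p) / (x - 0)"
    using continuous_on_arcsin_p_integrand[OF p0 x(2)] x
    by (intro powr_mean_less_mean_powr[OF p x(1) _ pos _ _ nonconst]) (auto simp: f_def)
  moreover have "f t powr p = inverse (1 - t powr p)" if "t \<in> {0..x}" for t
  proof -
    have "f t powr p = (1 - t powr p) powr (- 1)"
      using p by (simp add: f_def powr_powr)
    then show ?thesis using unit[OF that] by (simp add: powr_minus)
  qed
  then have "integral {0..x} (\<lambda>t. f t powr p) = arctanh_p p x"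
    unfolding arctanh_p_def by (rule integral_cong)
  ultimately show ?thesis by (simp add: arcsin_p_def f_def)
qed

text \<open>
  Write \<open>w = 1 - t powr p\<close>.  The derivative of \<open>arcsin_p p t - w powr (1 / p) * arctanh_p p t\<close> is
  \<open>w powr (- 1 / p) - w powr (1 / p - 1) + t powr (p - 1) * w powr (1 / p - 1) * arctanh_p p t\<close>.
  Since \<open>arctanh_p p t \<ge> t\<close>, this is at least \<open>w powr (- 1 / p) - w powr (1 / p)\<close>, which is positive
  because \<open>0 < w < 1\<close>.
\<close>
lemma arctanh_p_less_arcsin_p:
  fixes p x :: real
  assumes p: "p > 0" and x: "0 < x" "x < 1"
  shows "(1 - x powr p) powr (1 / p) * arctanh_p p x < arcsin_p p x"
proof -
  let ?h = "\<lambda>t. arcsin_p p t - (1 - t powr p) powr (1 / p) * arctanh_p p t"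
  note unit = powr_in_unit[OF p x(2)]
  note cS = continuous_on_arcsin_p_integrand[OF p x(2)]
  note cA = continuous_on_arctanh_p_integrand[OF p x(2)]
  have "?h 0 < ?h x"
  proof (rule DERIV_pos_imp_increasing_open[OF x(1)])
    show "continuous_on {0..x} ?h"
      unfolding arcsin_p_def arctanh_p_def
      using unit p
      by (intro continuous_on_diff continuous_on_mult continuous_on_powr' continuous_on_const
          continuous_on_powr_pos_exponent indefinite_integral_continuous_1
          integrable_continuous_real cS cA)
         (auto simp: less_imp_le)
  next
    fix t assume t: "0 < t" "t < x"
    define w where "w = 1 - t powr p"
    have w: "0 < w" "w < 1" using unit[of t] t by (auto simp: w_def)
    have interior: "at t within {0..x} = at t"
      using t by (intro at_within_interior) (auto simp: interior_atLeastAtMost_real)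
    have dS: "(arcsin_p p has_real_derivative w powr (- 1 / p)) (at t)"
      using integral_has_real_derivative[OF cS, of t] t
      by (simp add: interior w_def arcsin_p_def[abs_def])
    have dA: "(arctanh_p p has_real_derivative inverse w) (at t)"
      using integral_has_real_derivative[OF cA, of t] t
      by (simp add: interior w_def arctanh_p_def[abs_def])
    have dW: "((\<lambda>t. (1 - t powr p) powr (1 / p)) has_real_derivative
        - (t powr (p - 1) * w powr (1 / p - 1))) (at t)"
      using t w p by (auto intro!: derivative_eq_intros simp: w_def)
    have wp: "w powr (1 / p) = w * w powr (1 / p - 1)"
      using w by (simp add: powr_diff)
    have tp: "t powr p = t powr (p - 1) * t"
      using t by (simp add: powr_diff)
    let ?d = "w powr (- 1 / p) - (- (t powr (p - 1) * w powr (1 / p - 1)) * arctanh_p p t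
        + inverse w * w powr (1 / p))"
    have D: "DERIV ?h t :> ?d"
      using DERIV_diff[OF dS DERIV_mult'[OF dW dA]] by (simp add: w_def algebra_simps)
    have "t \<le> arctanh_p p t" using arctanh_p_ge_self[OF p] t x by simp
    then have "t powr (p - 1) * t \<le> t powr (p - 1) * arctanh_p p t"
      by (rule mult_left_mono) simp
    then have "w powr (1 / p - 1) * t powr p
        \<le> w powr (1 / p - 1) * (t powr (p - 1) * arctanh_p p t)"
      unfolding tp by (rule mult_left_mono) simp
    moreover have "inverse w * w powr (1 / p) = w powr (1 / p - 1)"
      using w by (simp add: wp)
    moreover have "w powr (1 / p - 1) * t powr p = w powr (1 / p - 1) - w powr (1 / p)"
      unfolding wp by (simp add: w_def algebra_simps)
    moreover have "w powr (1 / p) < 1" "1 < w powr (- 1 / p)"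
      using w p powr_less_mono'[of w "- 1 / p" 0] powr_less_mono'[of w 0 "1 / p"] by auto
    ultimately have "?d > 0" by (simp add: mult_ac)
    with D show "\<exists>y. DERIV ?h t :> y \<and> y > 0" by blast
  qed
  then show ?thesis by (simp add: arcsin_p_def arctanh_p_def)
qed

section \<open>Transformation of the inverse hyperbolic sine\<close>

text \<open>
  In the substitution \<open>u = t / s powr (1 / p)\<close> with \<open>s = 1 + t powr p\<close> one has
  \<open>du = s powr (- 1 / p - 1) dt\<close> and \<open>1 / (1 - u powr p) = s\<close>.  For \<open>p < 1\<close> the function
  \<open>t powr p\<close> is not differentiable at \<open>0\<close>, so the chain rule fails there; a substitution rule with a
  finite set of exceptional points avoids a separate treatment of that endpoint.
\<close>
lemma arcsinh_p_eq_arctanh_p: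
  fixes p x :: real
  assumes p: "p > 0" and x: "0 < x"
  shows "arcsinh_p p x = arctanh_p p ((x powr p / (1 + x powr p)) powr (1 / p))"
proof -
  define g where "g = (\<lambda>t::real. (t powr p / (1 + t powr p)) powr (1 / p))"
  have pos: "1 + t powr p > 0" for t
    by (simp add: add_pos_nonneg)
  have gp: "g t powr p = t powr p / (1 + t powr p)" for t
    using p pos[of t] by (simp add: g_def powr_powr)
  have g_alt: "g t = t * (1 + t powr p) powr (- 1 / p)" if "t \<ge> 0" for t
    using that p pos[of t] by (simp add: g_def powr_divide powr_powr powr_minus_divide)
  have g0: "g 0 = 0" using p by (simp add: g_def)
  have g_nonneg: "g t \<ge> 0" for t by (simp add: g_def)
  have g_mono: "g t \<le> g x" if "t \<in> {0..x}" for t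
  proof -
    have "t powr p \<le> x powr p" using that p by (intro powr_mono2) auto
    then have "t powr p / (1 + t powr p) \<le> x powr p / (1 + x powr p)"
      using pos[of t] pos[of x] by (simp add: field_simps)
    then show ?thesis using p pos[of t] by (auto simp: g_def intro!: powr_mono2)
  qed
  have "x powr p / (1 + x powr p) < 1" using pos[of x] by simp
  then have gx: "g x < 1"
    using powr_less_mono2[of "1 / p" "x powr p / (1 + x powr p)" 1] p pos[of x] by (simp add: g_def)
  have cont: "continuous_on {0..x} g"
    unfolding g_def using p pos
    by (intro continuous_on_powr' continuous_intros continuous_on_powr_pos_exponent)
       (auto simp: less_imp_neq[symmetric] less_imp_le)
  have der: "(g has_real_derivative (1 + t powr p) powr (- 1 / p - 1)) (at t within {0..x})"
    if "t \<in> {0..x} - {0}" for t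
  proof -
    have t: "t > 0" using that by auto
    have "((\<lambda>t. t * (1 + t powr p) powr (- 1 / p)) has_real_derivative
        (1 + t powr p) powr (- 1 / p)
          - t * (t powr (p - 1) * (1 + t powr p) powr (- 1 / p - 1))) (at t within {0..x})"
      using t p pos[of t] by (auto intro!: derivative_eq_intros)
    moreover have "(1 + t powr p) powr (- 1 / p)
          - t * (t powr (p - 1) * (1 + t powr p) powr (- 1 / p - 1))
        = (1 + t powr p) powr (- 1 / p - 1)"
    proof -
      have "(1 + t powr p) powr (- 1 / p) = (1 + t powr p) * (1 + t powr p) powr (- 1 / p - 1)"
        using pos[of t] by (simp add: powr_diff)
      moreover have "t * t powr (p - 1) = t powr p" using t by (simp add: powr_diff)
      ultimately show ?thesis by (simp add: algebra_simps flip: mult.assoc)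
    qed
    ultimately have "((\<lambda>t. t * (1 + t powr p) powr (- 1 / p)) has_real_derivative
        (1 + t powr p) powr (- 1 / p - 1)) (at t within {0..x})" by simp
    then show ?thesis
      by (rule has_field_derivative_transform_within[where d = 1]) (use that g_alt in auto)
  qed
  have "((\<lambda>t. (1 + t powr p) powr (- 1 / p - 1) *\<^sub>R inverse (1 - g t powr p)) has_integral
      (integral {g 0..g x} (\<lambda>u. inverse (1 - u powr p))
        - integral {g x..g 0} (\<lambda>u. inverse (1 - u powr p)))) {0..x}"
  proof (rule has_integral_substitution_general[where s = "{0}" and c = 0 and d = "g x"])
    show "continuous_on {0..g x} (\<lambda>u. inverse (1 - u powr p))"
      by (rule continuous_on_arctanh_p_integrand[OF p gx])
  qed (use x g_nonneg g_mono cont der in auto)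
  moreover have "integral {g x..g 0} (\<lambda>u. inverse (1 - u powr p)) = 0"
    using g_nonneg[of x] by (cases "g x = 0") (auto simp: g0)
  moreover have "(1 + t powr p) powr (- 1 / p - 1) *\<^sub>R inverse (1 - g t powr p)
      = (1 + t powr p) powr (- 1 / p)" for t
  proof -
    have "inverse (1 - g t powr p) = 1 + t powr p"
      unfolding gp using pos[of t] by (simp add: field_simps)
    then show ?thesis using pos[of t] by (simp add: powr_diff)
  qed
  ultimately have "arcsinh_p p x = arctanh_p p (g x)"
    by (simp add: arcsinh_p_def arctanh_p_def g0 integral_unique)
  then show ?thesis by (simp add: g_def)
qed

section \<open>The inequalities\<close>

lemma arctanh_p_div_less_arcsin_p_div:
  fixes p x :: real
  assumes "p > 0" "0 < x" "x < 1"
  shows "arctanh_p p x / x < arcsin_p p x / (x * (1 - x powr p) powr (1 / p))"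
  using arctanh_p_less_arcsin_p[OF assms] powr_in_unit[of p x x] assms
  by (simp add: field_simps)

text \<open>
  Both estimates are the bounds of \<open>arctanh_p p y\<close>, since \<open>1 - y powr p = 1 / (1 + x powr p)\<close> and the
  factor \<open>(x powr p / (1 + x powr p)) powr (1 / p - 1)\<close> equals \<open>y powr (1 - p)\<close>.
\<close>
lemma arcsinh_p_bounds:
  fixes p x :: real
  defines "y \<equiv> (x powr p / (1 + x powr p)) powr (1 / p)"
  assumes p: "p > 1" and x: "0 < x"
  shows "(x powr p / (1 + x powr p)) powr (1 / p - 1) * arcsin_p p y powr p < arcsinh_p p x"
    and "arcsinh_p p x < (1 + x powr p) powr (1 / p) * arcsin_p p y"
proof -
  have pos: "x powr p > 0" "1 + x powr p > 0" using x by (auto simp: add_pos_pos)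
  define q where "q = x powr p / (1 + x powr p)"
  have q: "0 < q" "q < 1" using pos by (auto simp: q_def)
  have y: "y = q powr (1 / p)" by (simp add: y_def q_def)
  have y01: "0 < y" "y < 1"
    using q p powr_less_mono2[of "1 / p" q 1] by (auto simp: y)
  have yp: "y powr p = q" using q p by (simp add: y powr_powr)
  have eq: "arcsinh_p p x = arctanh_p p y"
    using p x by (simp add: arcsinh_p_eq_arctanh_p y_def)
  have "0 \<le> arcsin_p p y"
    unfolding arcsin_p_def using p y01
    by (intro integral_nonneg integrable_continuous_real continuous_on_arcsin_p_integrand) auto
  then have "arcsin_p p y powr p / q < arctanh_p p y / y"
    using arcsin_p_powr_less_arctanh_p[OF p y01] y01 by (simp add: powr_divide yp)
  then have "y / q * arcsin_p p y powr p < arctanh_p p y"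
    using y01 q by (simp add: field_simps)
  moreover have "q powr (1 / p - 1) = y / q" using q by (simp add: powr_diff y)
  ultimately show "(x powr p / (1 + x powr p)) powr (1 / p - 1) * arcsin_p p y powr p
      < arcsinh_p p x"
    by (simp add: eq flip: q_def)
  have "1 - y powr p = 1 / (1 + x powr p)"
    using pos by (simp add: yp q_def field_simps)
  then have "(1 - y powr p) powr (1 / p) = 1 / (1 + x powr p) powr (1 / p)"
    using pos by (simp add: powr_divide)
  then show "arcsinh_p p x < (1 + x powr p) powr (1 / p) * arcsin_p p y"
    using arctanh_p_less_arcsin_p[of p y] p y01 pos by (simp add: eq divide_less_eq mult.commute)
qed

theorem theorem1:
  "(\<forall>p::real. \<forall>x::real. p > 1 \<and> 0 < x \<and> x < 1 \<longrightarrow>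
      (arcsin_p p x / x) powr p < arctanh_p p x / x \<and>
      arctanh_p p x / x < arcsin_p p x / (x * (1 - x powr p) powr (1 / p)) \<and>
      (x powr p / (1 + x powr p)) powr (1 / p - 1)
          * (arcsin_p p ((x powr p / (1 + x powr p)) powr (1 / p))) powr p
        < arcsinh_p p x \<and>
      arcsinh_p p x
        < (1 + x powr p) powr (1 / p)
            * arcsin_p p ((x powr p / (1 + x powr p)) powr (1 / p)))
   \<and>
   (\<forall>p::real. \<forall>x::real. p > 0 \<and> 0 < x \<and> x < 1 \<longrightarrow>
      arctanh_p p x / x < arcsin_p p x / (x * (1 - x powr p) powr (1 / p)))"
  using arcsin_p_powr_less_arctanh_p arctanh_p_div_less_arcsin_p_div arcsinh_p_bounds by simp

end
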